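(* Let $G$ be a graph with an odd number $n\geq 9$ of vertices, and let $\overline{G}$ be its complement. Then $\mathrm{mp}(G)+\mathrm{mp}(\overline{G})=2n-3$ if and only if $G=K_n$ or $\overline{G}=K_n$.
   Context: All graphs are finite, simple and undirected; $\overline{G}$ is the complement of $G$. A perfect matching is a set of edges covering every vertex exactly once; an almost-perfect matching is a set of edges covering every vertex except one exactly once and missing the remaining vertex. The matching preclusion number $\mathrm{mp}(G)$ is the minimum number of edges whose deletion leaves a graph with neither a perfect matching nor an almost-perfect matching ($\mathrm{mp}(G)=0$ if $G$ has neither). *)

theory Defs
  imports Main
begin

text \<open>An undirected graph is a pair of a vertex set and a set of two-element sets of vertices.\<close>

type_synonym 'a ugraph = "'a set \<times> 'a set set"

abbreviation verts :: "'a ugraph \<Rightarrow> 'a set" where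
  "verts G \<equiv> fst G"

abbreviation edges :: "'a ugraph \<Rightarrow> 'a set set" where
  "edges G \<equiv> snd G"

definition vertex_pairs :: "'a set \<Rightarrow> 'a set set" where
  "vertex_pairs V = {{u, v} | u v. u \<in> V \<and> v \<in> V \<and> u \<noteq> v}"

definition simple_graph :: "'a ugraph \<Rightarrow> bool" where
  "simple_graph G \<longleftrightarrow> finite (verts G) \<and> edges G \<subseteq> vertex_pairs (verts G)"

definition complement_graph :: "'a ugraph \<Rightarrow> 'a ugraph" where
  "complement_graph G = (verts G, vertex_pairs (verts G) - edges G)"

definition complete_graph :: "'a set \<Rightarrow> 'a ugraph" where
  "complete_graph V = (V, vertex_pairs V)"

definition delete_edges :: "'a ugraph \<Rightarrow> 'a set set \<Rightarrow> 'a ugraph" where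
  "delete_edges G F = (verts G, edges G - F)"

definition perfect_matching :: "'a ugraph \<Rightarrow> 'a set set \<Rightarrow> bool" where
  "perfect_matching G M \<longleftrightarrow> M \<subseteq> edges G \<and> (\<forall>v\<in>verts G. \<exists>!e. e \<in> M \<and> v \<in> e)"

definition almost_perfect_matching :: "'a ugraph \<Rightarrow> 'a set set \<Rightarrow> bool" where
  "almost_perfect_matching G M \<longleftrightarrow> M \<subseteq> edges G \<and>
     (\<exists>w\<in>verts G. (\<forall>v\<in>verts G - {w}. \<exists>!e. e \<in> M \<and> v \<in> e) \<and> (\<forall>e\<in>M. w \<notin> e))"

definition matching_preclusion_set :: "'a ugraph \<Rightarrow> 'a set set \<Rightarrow> bool" where
  "matching_preclusion_set G F \<longleftrightarrow> F \<subseteq> edges G \<and>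
     (\<nexists>M. perfect_matching (delete_edges G F) M) \<and>
     (\<nexists>M. almost_perfect_matching (delete_edges G F) M)"

text \<open>If \<open>G\<close> has neither a perfect nor an almost-perfect matching, the empty set is a
  matching preclusion set and \<open>mp G = 0\<close>. For a simple graph with at least two vertices the
  minimum is attained (lemma \<open>matching_preclusion_set_edges\<close>); with fewer vertices no matching
  preclusion set exists and \<open>mp G\<close> is unspecified.\<close>

definition mp :: "'a ugraph \<Rightarrow> nat" where
  "mp G = (LEAST k. \<exists>F. matching_preclusion_set G F \<and> card F = k)"

lemma matching_preclusion_set_edges:
  assumes "simple_graph G" and "card (verts G) \<ge> 2"
  shows "matching_preclusion_set G (edges G)"
proof -
  have two: "\<exists>v\<in>verts G. v \<noteq> w" for w
  proof (rule ccontr)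
    assume "\<not> ?thesis"
    then have "verts G \<subseteq> {w}" by blast
    then have "card (verts G) \<le> card {w}" by (intro card_mono) auto
    with assms(2) show False by simp
  qed
  then show ?thesis
    by (fastforce simp: matching_preclusion_set_def perfect_matching_def
        almost_perfect_matching_def delete_edges_def)
qed

end

(* Deleting all edges at u or v leaves no (almost-)perfect matching, so for all u and v
   mp G <= d(u) + d(v) - [uv in E]. Adding the same bound for the complement gives 2n - 3; in the
   case of equality d(u) + d(v) - [uv in E] is therefore constant over all pairs, which only
   happens in complete and empty graphs. Conversely mp(K_n) = 2n - 3 requires that a graph on n
   vertices with at most 2n - 4 non-edges has a matching of size (n - 1)/2, which follows by
   counting the non-edges forced by the absence of short augmenting paths. *)

theory Submission imports Defs
begin

section \<open>Pairs of vertices and matchings in complete graphs\<close>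

lemma vertex_pairs_iff: "{u, v} \<in> vertex_pairs V \<longleftrightarrow> u \<in> V \<and> v \<in> V \<and> u \<noteq> v"
  unfolding vertex_pairs_def by (auto simp: doubleton_eq_iff)

lemma vertex_pairsE:
  assumes "e \<in> vertex_pairs V"
  obtains u v where "e = {u, v}" "u \<in> V" "v \<in> V" "u \<noteq> v"
  using assms unfolding vertex_pairs_def by blast

lemma vertex_pairs_eq: "vertex_pairs V = {e. e \<subseteq> V \<and> card e = 2}"
  unfolding vertex_pairs_def by (auto simp: card_2_iff)

lemma finite_vertex_pairs: "finite V \<Longrightarrow> finite (vertex_pairs V)"
  unfolding vertex_pairs_eq by simp

lemma card_vertex_pairs: "finite V \<Longrightarrow> card (vertex_pairs V) = card V choose 2"
  unfolding vertex_pairs_eq by (rule n_subsets)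

lemma card_Union_matching:
  assumes "M \<subseteq> vertex_pairs V" "pairwise disjnt M"
  shows "card (\<Union>M) = 2 * card M"
proof -
  have "card (\<Union>M) = sum card M"
    using assms by (intro card_Union_disjoint) (auto elim!: vertex_pairsE)
  also have "\<dots> = (\<Sum>e\<in>M. 2)"
    using assms(1) by (intro sum.cong) (auto simp: vertex_pairs_eq)
  finally show ?thesis by simp
qed

text \<open>Greedy choice: \<open>k\<close> disjoint edges leave two free vertices as long as
  \<open>2 * k + 2 \<le> card V\<close>. This starts the later induction on the set \<open>X\<close>
  of non-edges.\<close>

lemma complete_graph_matching_exists:
  assumes "finite V" "2 * k \<le> card V"
  shows "\<exists>M\<subseteq>vertex_pairs V. pairwise disjnt M \<and> card M = k"
  using assms(2)
proof (induction k)
  case 0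
  show ?case by (rule exI[of _ "{}"]) simp
next
  case (Suc k)
  then obtain M where M: "M \<subseteq> vertex_pairs V" "pairwise disjnt M" "card M = k"
    by auto
  have fin: "finite M" using M(1) assms(1) finite_vertex_pairs finite_subset by blast
  have sub: "\<Union>M \<subseteq> V" using M(1) by (auto simp: vertex_pairs_eq)
  have "card (V - \<Union>M) = card V - 2 * k"
    using card_Union_matching[OF M(1,2)] M(3) sub assms(1)
    by (simp add: card_Diff_subset finite_subset)
  then have "2 \<le> card (V - \<Union>M)" using Suc.prems by simp
  then obtain e where e: "e \<subseteq> V - \<Union>M" "card e = 2"
    by (meson obtain_subset_with_card_n)
  then have "e \<noteq> {}" by auto
  then have "e \<notin> M" using e by auto
  moreover have "pairwise disjnt (insert e M)"
    using M(2) e(1) by (auto simp: pairwise_insert disjnt_def)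
  ultimately show ?case
    using M e fin by (intro exI[of _ "insert e M"]) (auto simp: vertex_pairs_eq)
qed

section \<open>Non-edges forced by the absence of large matchings\<close>

text \<open>Only augmenting paths of length 1, 3 and 5 have to be excluded. With \<open>U\<close> the three
  uncovered vertices, a matching edge generically accounts for four non-edges to \<open>U\<close>. The
  exceptional edges \<open>{a, b}\<close> (the set \<open>R\<close>), with \<open>a\<close> joined to all of \<open>U\<close>, account for only
  three; but their other ends \<open>b\<close> (the set \<open>W\<close>) are pairwise non-adjacent, and each of them
  misses an end of every other matching edge that has only four non-edges to \<open>U\<close>.\<close>

lemma card_non_edges_of_maximum_matching:
  assumes fV: "finite V" and X: "X \<subseteq> vertex_pairs V"
    and M: "M \<subseteq> vertex_pairs V - X" "pairwise disjnt M"
    and s: "card M \<ge> 3" and V: "card V = 2 * card M + 3"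
    and max: "\<And>N. N \<subseteq> vertex_pairs V - X \<Longrightarrow> pairwise disjnt N \<Longrightarrow> card N \<noteq> Suc (card M)"
  shows "4 * card M + 3 \<le> card X"
proof -
  define U where "U = V - \<Union>M"
  have MV: "M \<subseteq> vertex_pairs V" using M(1) by blast
  have fM: "finite M" using MV fV finite_vertex_pairs finite_subset by blast
  have fX: "finite X" using X fV finite_vertex_pairs finite_subset by blast
  have UMV: "\<Union>M \<subseteq> V" using MV by (auto simp: vertex_pairs_eq)
  have cU: "card U = 3"
    using card_Union_matching[OF MV M(2)] UMV fV V
    by (simp add: U_def card_Diff_subset finite_subset)
  have fU: "finite U" using fV by (simp add: U_def)
  have UV: "U \<subseteq> V" by (auto simp: U_def)
  have UM: "e \<inter> U = {}" if "e \<in> M" for e using that by (auto simp: U_def)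
  have same: "e = f" if "e \<in> M" "f \<in> M" "v \<in> e" "v \<in> f" for e f v
    using that M(2) by (auto simp: pairwise_def disjnt_def)
  have split_U: "\<exists>y z. U = {x, y, z} \<and> x \<noteq> y \<and> x \<noteq> z \<and> y \<noteq> z" if "x \<in> U" for x
  proof -
    have "card (U - {x}) = 2" using that cU fU by simp
    then obtain y z where yz: "U - {x} = {y, z}" "y \<noteq> z" by (auto simp: card_2_iff)
    have "U = insert x (U - {x})" "x \<notin> U - {x}" using that by auto
    then show ?thesis unfolding yz(1) using yz(2) by blast
  qed
  \<comment> \<open>All augmentations in one form: \<open>Q\<close> replaces the edges of
    \<open>P\<close>, uses only their ends and vertices of \<open>U\<close>, and gains one edge. It
    is applied to paths with 1, 3 and 5 edges.\<close>
  have exchange: False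
    if P: "P \<subseteq> M" and Q: "finite Q" "Q \<subseteq> vertex_pairs V - X" "pairwise disjnt Q"
      "\<Union>Q \<subseteq> U \<union> \<Union>P" "card Q = Suc (card P)" for P Q
  proof -
    have dj: "disjnt e q" if eq: "e \<in> M - P" "q \<in> Q" for e q
      unfolding disjnt_iff
    proof (intro allI notI)
      fix v assume v: "v \<in> e \<and> v \<in> q"
      then have "v \<in> U \<union> \<Union>P" using Q(4) eq(2) by blast
      moreover have "v \<notin> U" using UM[of e] eq(1) v by blast
      ultimately obtain f where "f \<in> P" "v \<in> f" by blast
      then show False using same[of e f v] eq(1) P v by blast
    qed
    have ne: "q \<noteq> {}" if "q \<in> Q" for q
      using Q(2) that by (auto elim!: vertex_pairsE)
    have "(M - P) \<inter> Q = {}"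
      using dj ne by (fastforce simp: disjnt_def)
    then have "card ((M - P) \<union> Q) = card (M - P) + card Q"
      using fM Q(1) by (intro card_Un_disjoint) auto
    also have "\<dots> = Suc (card M)"
      using P fM Q(5) card_mono[OF fM P] by (simp add: card_Diff_subset finite_subset)
    finally have c: "card ((M - P) \<union> Q) = Suc (card M)" .
    have "pairwise disjnt ((M - P) \<union> Q)"
      unfolding pairwise_def
      using M(2) Q(3) dj by (auto simp: pairwise_def disjnt_sym)
    with max[of "(M - P) \<union> Q"] c M(1) Q(2) show False by blast
  qed
  have aug1: "{x, y} \<in> X" if "x \<in> U" "y \<in> U" "x \<noteq> y" for x y
    using exchange[of "{}" "{{x, y}}"] that UV by (auto simp: vertex_pairs_iff)
  have aug3: "{a, x} \<in> X \<or> {b, y} \<in> X"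
    if "{a, b} \<in> M" "x \<in> U" "y \<in> U" "x \<noteq> y" for a b x y
  proof (rule ccontr)
    assume n: "\<not> ?thesis"
    have "{a, b} \<in> vertex_pairs V" using that MV by blast
    then have ab: "a \<in> V" "b \<in> V" "a \<noteq> b" by (auto simp: vertex_pairs_iff)
    have nU: "a \<notin> U" "b \<notin> U" using UM[OF that(1)] by auto
    have "{a, x} \<noteq> {b, y}" using ab nU that by (auto simp: doubleton_eq_iff)
    then show False
      using exchange[of "{{a, b}}" "{{a, x}, {b, y}}"] that UV ab nU n
      by (auto simp: vertex_pairs_iff pairwise_insert disjnt_def)
  qed
  \<comment> \<open>Otherwise \<open>x, a, b, d, c, y\<close> is an augmenting path with matching
    edges \<open>{a, b}\<close> and \<open>{c, d}\<close>.\<close>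
  have aug5: "{b, d} \<in> X"
    if e: "{a, b} \<in> M" "{c, d} \<in> M" "{a, b} \<noteq> {c, d}" and xy: "x \<in> U" "y \<in> U" "x \<noteq> y"
      and n: "{a, x} \<notin> X" "{c, y} \<notin> X" for a b c d x y
  proof (rule ccontr)
    assume nX: "{b, d} \<notin> X"
    have "{a, b} \<in> vertex_pairs V" "{c, d} \<in> vertex_pairs V" using e MV by auto
    then have V: "a \<in> V" "b \<in> V" "a \<noteq> b" "c \<in> V" "d \<in> V" "c \<noteq> d"
      by (auto simp: vertex_pairs_iff)
    have nU: "a \<notin> U" "b \<notin> U" "c \<notin> U" "d \<notin> U" using UM[OF e(1)] UM[OF e(2)] by auto
    have dist: "a \<noteq> c" "a \<noteq> d" "b \<noteq> c" "b \<noteq> d" using same[OF e(1,2)] e(3) by blast+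
    have "card {{a, x}, {c, y}, {b, d}} = 3" "card {{a, b}, {c, d}} = 2"
      using V nU dist xy by (auto simp: doubleton_eq_iff card_insert_if)
    then show False
      using exchange[of "{{a, b}, {c, d}}" "{{a, x}, {c, y}, {b, d}}"] e xy UV V nU dist n nX
      by (auto simp: vertex_pairs_iff pairwise_insert disjnt_def)
  qed
  define W where "W = {b. \<exists>a. {a, b} \<in> M \<and> (\<forall>x\<in>U. {a, x} \<notin> X)}"
  define R where "R = {e \<in> M. e \<inter> W \<noteq> {}}"
  \<comment> \<open>The non-edges charged to \<open>e\<close>. Pairs towards \<open>W\<close> are
    charged only to edges outside \<open>R\<close>, so that no pair is charged twice and the pairs
    inside \<open>W\<close> remain to be counted separately.\<close>
  define D where "D e = {p \<in> X. \<exists>v\<in>e. \<exists>w. p = {v, w} \<and> (w \<in> U \<or> (e \<notin> R \<and> w \<in> W))}" for e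
  have fD: "finite (D e)" for e using fX by (simp add: D_def)
  have WM: "W \<subseteq> \<Union>M" unfolding W_def by blast
  have fW: "finite W" by (rule finite_subset[OF subset_trans[OF WM UMV] fV])
  have WU: "W \<inter> U = {}" using WM by (auto simp: U_def)
  have W_none: "{b, x} \<in> X" if bW: "b \<in> W" and xU: "x \<in> U" for b x
  proof -
    obtain a where a: "{a, b} \<in> M" "\<forall>x\<in>U. {a, x} \<notin> X" using bW by (auto simp: W_def)
    obtain y where "y \<in> U" "x \<noteq> y" using split_U[OF xU] by blast
    then show ?thesis using aug3[OF a(1) _ xU, of y] a(2) by auto
  qed
  \<comment> \<open>If both ends were in \<open>W\<close>, one of them would be joined to all of
    \<open>U\<close> as the partner of the other, and to none of it by
    \<open>W_none\<close>.\<close>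
  have W_unique: "b = c" if bc: "b \<in> W" "c \<in> W" and e: "e \<in> M" "b \<in> e" "c \<in> e" for b c e
  proof (rule ccontr)
    assume "b \<noteq> c"
    obtain a where a: "{a, b} \<in> M" "\<forall>x\<in>U. {a, x} \<notin> X" using bc(1) by (auto simp: W_def)
    have "e = {a, b}" using same[OF a(1) e(1)] e by blast
    then have "a = c" using \<open>b \<noteq> c\<close> e(3) by auto
    moreover obtain x where "x \<in> U" using cU by fastforce
    ultimately show False using W_none[OF bc(2)] a(2) by auto
  qed
  have W_pairs: "{b, d} \<in> X" if bd: "b \<in> W" "d \<in> W" "b \<noteq> d" for b d
  proof -
    obtain a where a: "{a, b} \<in> M" "\<forall>x\<in>U. {a, x} \<notin> X" using bd by (auto simp: W_def)
    obtain c where c: "{c, d} \<in> M" "\<forall>x\<in>U. {c, x} \<notin> X" using bd by (auto simp: W_def)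
    have ne: "{a, b} \<noteq> {c, d}" using W_unique[OF bd(1,2) a(1)] bd(3) by blast
    obtain x where x: "x \<in> U" using cU by fastforce
    obtain y where y: "y \<in> U" "x \<noteq> y" using split_U[OF x] by blast
    show ?thesis using aug5[OF a(1) c(1) ne x y] a c x y by auto
  qed
  have card_RW: "card R = card W"
  proof -
    have "bij_betw (\<lambda>e. THE b. b \<in> e \<inter> W) R W"
    proof -
      have the: "(THE b. b \<in> e \<inter> W) \<in> e \<inter> W" if "e \<in> R" for e
        by (rule theI') (use that W_unique in \<open>auto simp: R_def\<close>)
      show ?thesis
      proof (rule bij_betwI')
        fix e f assume ef: "e \<in> R" "f \<in> R"
        have "e = f" if "(THE b. b \<in> e \<inter> W) = (THE b. b \<in> f \<inter> W)"
          using same[of e f] the[OF ef(1)] the[OF ef(2)] ef that unfolding R_def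
          by (metis (no_types, lifting) Int_iff mem_Collect_eq)
        then show "((THE b. b \<in> e \<inter> W) = (THE b. b \<in> f \<inter> W)) = (e = f)" by blast
      next
        fix e assume "e \<in> R"
        then show "(THE b. b \<in> e \<inter> W) \<in> W" using the by blast
      next
        fix b assume b: "b \<in> W"
        then obtain e where e: "e \<in> M" "b \<in> e" using WM by blast
        then have eR: "e \<in> R" using b by (auto simp: R_def)
        have "b = (THE b. b \<in> e \<inter> W)"
          using the[OF eR] W_unique[OF b _ e(1,2)] by blast
        then show "\<exists>e\<in>R. b = (THE b. b \<in> e \<inter> W)" using eR by blast
      qed
    qed
    then show ?thesis by (rule bij_betw_same_card)
  qed
  have D_R: "3 \<le> card (D e)" if e: "e \<in> R" for e
  proof -
    obtain b where b: "b \<in> e" "b \<in> W" using e by (auto simp: R_def)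
    have "b \<notin> U" using b WU by blast
    then have "inj_on (\<lambda>x. {b, x}) U" by (auto simp: inj_on_def doubleton_eq_iff)
    then have "card ((\<lambda>x. {b, x}) ` U) = 3" by (simp add: card_image cU)
    moreover have "(\<lambda>x. {b, x}) ` U \<subseteq> D e" using b W_none by (auto simp: D_def)
    ultimately show ?thesis using card_mono[OF fD] by metis
  qed
  \<comment> \<open>The end \<open>c\<close> is joined to \<open>x\<close> in \<open>U\<close>, so
    by \<open>aug3\<close> the other end \<open>d\<close> misses the two remaining vertices of
    \<open>U\<close>. Two more non-edges come from the cases on \<open>{d, x}\<close>, and a fifth
    one goes from \<open>d\<close> to \<open>W\<close>.\<close>
  have D_case: "4 \<le> card (D e) \<and> (W \<noteq> {} \<longrightarrow> 5 \<le> card (D e))"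
    if e: "e = {c, d}" "e \<in> M" "e \<notin> R" and x: "x \<in> U" "{c, x} \<notin> X" for e c d x
  proof -
    have "e \<in> vertex_pairs V" using e MV by auto
    then have cd: "c \<noteq> d" using e by (auto simp: vertex_pairs_iff)
    have nU: "c \<notin> U" "d \<notin> U" using UM[OF e(2)] e by auto
    have nW: "c \<notin> W" "d \<notin> W" using e by (auto simp: R_def)
    obtain y z where U: "U = {x, y, z}" "x \<noteq> y" "x \<noteq> z" "y \<noteq> z"
      using split_U[OF x(1)] by blast
    have eM: "{c, d} \<in> M" "{d, c} \<in> M" using e by (auto simp: insert_commute)
    have dy: "{d, y} \<in> X" and dz: "{d, z} \<in> X"
      using aug3[OF eM(1), of x y] aug3[OF eM(1), of x z] U x by auto
    obtain S where S: "S \<subseteq> D e" "card S = 4" "\<Union>S \<subseteq> {c, d} \<union> U"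
    proof (cases "{d, x} \<in> X")
      case True
      \<comment> \<open>Here \<open>d\<close> misses all of \<open>U\<close>; as it is not in
        \<open>W\<close>, its partner \<open>c\<close> must miss some \<open>w\<close> in
        \<open>U\<close>.\<close>
      have "d \<notin> W" using nW by blast
      then obtain w where w: "w \<in> U" "{c, w} \<in> X" using eM by (auto simp: W_def)
      have "card {{d, x}, {d, y}, {d, z}, {c, w}} = 4"
        using cd nU U w by (auto simp: doubleton_eq_iff card_insert_if)
      moreover have "{{d, x}, {d, y}, {d, z}, {c, w}} \<subseteq> D e"
        using True dy dz w U e by (auto simp: D_def)
      ultimately show thesis using w U by (intro that[of "{{d, x}, {d, y}, {d, z}, {c, w}}"]) auto
    next
      case False
      have "{c, y} \<in> X" "{c, z} \<in> X"
        using aug3[OF eM(2), of x y] aug3[OF eM(2), of x z] U False by auto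
      moreover have "card {{c, y}, {c, z}, {d, y}, {d, z}} = 4"
        using cd nU U by (auto simp: doubleton_eq_iff card_insert_if)
      ultimately show thesis using dy dz U e
        by (intro that[of "{{c, y}, {c, z}, {d, y}, {d, z}}"]) (auto simp: D_def)
    qed
    have "5 \<le> card (D e)" if W: "W \<noteq> {}"
    proof -
      obtain b where b: "b \<in> W" using W by blast
      then obtain a where a: "{a, b} \<in> M" "\<forall>x\<in>U. {a, x} \<notin> X" by (auto simp: W_def)
      have ne: "{a, b} \<noteq> {c, d}" using b nW by auto
      \<comment> \<open>The excluded path is \<open>y, a, b, d, c, x\<close>, where \<open>a\<close>
        is joined to all of \<open>U\<close> and \<open>c\<close> to \<open>x\<close>.\<close>
      have "{b, d} \<in> X"
        using aug5[OF a(1) eM(1) ne, of y x] a(2) U x by auto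
      then have "{b, d} \<in> D e"
        using e b by (auto simp: D_def insert_commute)
      moreover have "b \<notin> U" "b \<noteq> c" "b \<noteq> d" using b WU nW by auto
      then have "{b, d} \<notin> S" using S(3) by auto
      ultimately have "insert {b, d} S \<subseteq> D e" "card (insert {b, d} S) = 5"
        using S finite_subset[OF S(1) fD] by auto
      then show ?thesis using card_mono[OF fD] by metis
    qed
    moreover have "4 \<le> card (D e)" using card_mono[OF fD S(1)] S(2) by simp
    ultimately show ?thesis by blast
  qed
  have D_nR: "4 \<le> card (D e) \<and> (W \<noteq> {} \<longrightarrow> 5 \<le> card (D e))" if e: "e \<in> M - R" for e
  proof -
    have "e \<in> vertex_pairs V" using e MV by auto
    then obtain c d where cd: "e = {c, d}" "c \<noteq> d" by (auto elim: vertex_pairsE)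
    consider x where "x \<in> U" "{c, x} \<notin> X" | x where "x \<in> U" "{d, x} \<notin> X"
      | "\<forall>x\<in>U. {c, x} \<in> X \<and> {d, x} \<in> X" by blast
    then show ?thesis
    proof cases
      case 1
      then show ?thesis using D_case[OF cd(1)] e by blast
    next
      case 2
      have "e = {d, c}" using cd by blast
      then show ?thesis using D_case[of e d c] e 2 by blast
    next
      case 3
      obtain x where "x \<in> U" using cU by fastforce
      then obtain y z where U: "U = {x, y, z}" "x \<noteq> y" "x \<noteq> z" "y \<noteq> z"
        using split_U by blast
      have nU: "c \<notin> U" "d \<notin> U" using UM[of e] e cd by auto
      \<comment> \<open>Neither end is joined to \<open>U\<close>; five of the six non-edges suffice
        for both bounds.\<close>
      let ?S = "{{c, x}, {c, y}, {c, z}, {d, x}, {d, y}}"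
      have "card ?S = 5" using cd nU U by (auto simp: doubleton_eq_iff card_insert_if)
      moreover have "?S \<subseteq> D e" using 3 cd U by (auto simp: D_def)
      ultimately have "5 \<le> card (D e)" using card_mono[OF fD] by metis
      then show ?thesis by simp
    qed
  qed
  have RM: "R \<subseteq> M" by (auto simp: R_def)
  have WR: "e \<in> R" if "e \<in> M" "w \<in> W" "w \<in> e" for e w using that by (auto simp: R_def)
  have disj: "D e \<inter> D f = {}" if ef: "e \<in> M" "f \<in> M" "e \<noteq> f" for e f
  proof (rule ccontr)
    assume "D e \<inter> D f \<noteq> {}"
    then obtain v w v' w' where vw: "{v, w} = {v', w'}" "v \<in> e" "v' \<in> f"
      "w \<in> U \<or> (e \<notin> R \<and> w \<in> W)" "w' \<in> U \<or> (f \<notin> R \<and> w' \<in> W)"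
      unfolding D_def by blast
    have "v \<noteq> v'" using same[OF ef(1,2)] ef(3) vw by blast
    then have "v = w'" "w = v'" using vw(1) by (auto simp: doubleton_eq_iff)
    \<comment> \<open>The shared pair runs between \<open>e\<close> and \<open>f\<close>. Neither
      end is in \<open>U\<close>, so both are in \<open>W\<close> while \<open>e\<close> and
      \<open>f\<close> lie outside \<open>R\<close>, against \<open>WR\<close>.\<close>
    then show False using vw UM[OF ef(1)] UM[OF ef(2)] WR[OF ef(1)] WR[OF ef(2)] by blast
  qed
  have D_sub: "p \<inter> U = {} \<Longrightarrow> \<not> p \<subseteq> W" "\<not> p \<subseteq> U" if "p \<in> D e" "e \<in> M" for p e
    using that UM[of e] WR[of e] by (auto simp: D_def)
  have "card (vertex_pairs U) = 3"
    by (simp add: card_vertex_pairs fU cU choose_two)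
  moreover have "card (vertex_pairs W) = card W choose 2"
    by (rule card_vertex_pairs[OF fW])
  moreover have "card (\<Union>e\<in>M. D e) = (\<Sum>e\<in>M. card (D e))"
    using fM fD disj by (intro card_UN_disjoint) auto
  moreover have "vertex_pairs U \<inter> vertex_pairs W = {}"
    using WU by (auto elim!: vertex_pairsE simp: doubleton_eq_iff)
  moreover have "(vertex_pairs U \<union> vertex_pairs W) \<inter> (\<Union>e\<in>M. D e) = {}"
  proof -
    have "p \<notin> D e" if "e \<in> M" "p \<in> vertex_pairs U \<union> vertex_pairs W" for e p
      using D_sub[OF _ that(1), of p] that(2) WU by (auto simp: vertex_pairs_eq)
    then show ?thesis by blast
  qed
  ultimately have "card ((vertex_pairs U \<union> vertex_pairs W) \<union> (\<Union>e\<in>M. D e))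
      = 3 + (card W choose 2) + (\<Sum>e\<in>M. card (D e))"
    using finite_vertex_pairs[OF fU] finite_vertex_pairs[OF fW] fM fD
    by (simp add: card_Un_disjoint)
  moreover have "(vertex_pairs U \<union> vertex_pairs W) \<union> (\<Union>e\<in>M. D e) \<subseteq> X"
    using aug1 W_pairs by (auto simp: D_def elim!: vertex_pairsE)
  ultimately have total: "3 + (card W choose 2) + (\<Sum>e\<in>M. card (D e)) \<le> card X"
    using card_mono[OF fX] by metis
  have "(\<Sum>e\<in>M. card (D e)) = (\<Sum>e\<in>R. card (D e)) + (\<Sum>e\<in>M - R. card (D e))"
    using sum.subset_diff[OF RM fM, of "\<lambda>e. card (D e)"] by (simp add: add.commute)
  moreover have "3 * card R \<le> (\<Sum>e\<in>R. card (D e))"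
    using sum_bounded_below[of R 3 "\<lambda>e. card (D e)"] D_R by (simp add: mult.commute)
  moreover have "4 * card (M - R) \<le> (\<Sum>e\<in>M - R. card (D e))"
    using sum_bounded_below[of "M - R" 4 "\<lambda>e. card (D e)"] D_nR by (simp add: mult.commute)
  moreover have "5 * card (M - R) \<le> (\<Sum>e\<in>M - R. card (D e))" if "W \<noteq> {}"
    using sum_bounded_below[of "M - R" 5 "\<lambda>e. card (D e)"] D_nR that by (simp add: mult.commute)
  moreover have "card M = card R + card (M - R)"
    using card_Un_disjoint[of R "M - R"] RM fM finite_subset[OF RM fM] by (simp add: Un_absorb1)
  moreover have "card W \<le> card W choose 2" if "3 \<le> card W"
  proof -
    have "card W * 2 \<le> card W * (card W - 1)" using that by (intro mult_left_mono) auto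
    then have "card W * 2 div 2 \<le> card W * (card W - 1) div 2" by (rule div_le_mono)
    then show ?thesis by (simp add: choose_two)
  qed
  moreover have "card W choose 2 = 1" if "card W = 2" using that by simp
  moreover have "W \<noteq> {} \<longleftrightarrow> card W > 0" using fW by (simp add: card_gt_0_iff)
  \<comment> \<open>Put \<open>m = card M\<close> and \<open>r = card W\<close>. For
    \<open>r = 0\<close> the total is at least \<open>3 + 4 * m\<close>. Otherwise it is at least
    \<open>3 + (r choose 2) + 3 * r + 5 * (m - r)\<close>, so
    \<open>2 * r \<le> m + (r choose 2)\<close> is needed: clear for \<open>r = 1\<close>, exactly
    \<open>m \<ge> 3\<close> for \<open>r = 2\<close>, and for larger \<open>r\<close> a consequence
    of \<open>r \<le> m\<close> and \<open>r \<le> r choose 2\<close>.\<close>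
  ultimately show ?thesis using total s card_RW
    by (cases "card W = 0"; cases "card W = 1"; cases "card W = 2") auto
qed

text \<open>Discarding non-edges one at a time raises the matching number by at most one per step,
  so it passes through \<open>k - 1\<close> and the previous lemma applies there.\<close>

lemma card_non_edges_of_no_near_perfect_matching:
  assumes fV: "finite V" and V: "card V = 2 * k + 1" and k: "k \<ge> 4"
  shows "finite X \<Longrightarrow> X \<subseteq> vertex_pairs V \<Longrightarrow>
    \<nexists>M. M \<subseteq> vertex_pairs V - X \<and> pairwise disjnt M \<and> card M = k \<Longrightarrow>
    4 * k - 1 \<le> card X"
proof (induction X rule: finite_induct)
  case empty
  then show ?case using complete_graph_matching_exists[OF fV, of k] V by auto
next
  case (insert e X)
  show ?case
  proof (cases "\<exists>M. M \<subseteq> vertex_pairs V - insert e X \<and> pairwise disjnt M \<and> card M = k - 1")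
    case True
    then obtain M where M: "M \<subseteq> vertex_pairs V - insert e X" "pairwise disjnt M" "card M = k - 1"
      by blast
    have "4 * card M + 3 \<le> card (insert e X)"
    proof (rule card_non_edges_of_maximum_matching[OF fV insert.prems(1) M(1,2)])
      show "card M \<ge> 3" "card V = 2 * card M + 3" using M(3) k V by auto
      show "card N \<noteq> Suc (card M)" if "N \<subseteq> vertex_pairs V - insert e X" "pairwise disjnt N" for N
        using insert.prems(2) that M(3) k by auto
    qed
    then show ?thesis using M(3) k by simp
  next
    case False
    \<comment> \<open>A matching of size \<open>k\<close> avoiding \<open>X\<close> either contains
      \<open>e\<close>, and then loses only \<open>e\<close> and has the excluded size
      \<open>k - 1\<close>, or it avoids \<open>insert e X\<close> as well.\<close>
    have "\<nexists>M. M \<subseteq> vertex_pairs V - X \<and> pairwise disjnt M \<and> card M = k"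
    proof
      assume "\<exists>M. M \<subseteq> vertex_pairs V - X \<and> pairwise disjnt M \<and> card M = k"
      then obtain M where M: "M \<subseteq> vertex_pairs V - X" "pairwise disjnt M" "card M = k" by blast
      show False
      proof (cases "e \<in> M")
        case True
        have "M - {e} \<subseteq> vertex_pairs V - insert e X" using M(1) by blast
        moreover have "pairwise disjnt (M - {e})" using M(2) by (rule pairwise_subset) blast
        moreover have "card (M - {e}) = k - 1" using True M(3) by simp
        ultimately show False using False by blast
      next
        case False
        then show False using insert.prems(2) M by blast
      qed
    qed
    then have "4 * k - 1 \<le> card X" using insert.IH insert.prems by blast
    then show ?thesis using insert.hyps by simp
  qed
qed

text \<open>Links the counting form of a matching to the definition: disjoint edges cover
  \<open>2 * card M\<close> vertices, so exactly one vertex is left to be the missed one.\<close>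

lemma almost_perfect_matchingI:
  assumes "finite V" "card V = 2 * card M + 1" "M \<subseteq> vertex_pairs V - F" "pairwise disjnt M"
  shows "almost_perfect_matching (delete_edges (V, vertex_pairs V) F) M"
proof -
  have MV: "M \<subseteq> vertex_pairs V" using assms(3) by blast
  then have sub: "\<Union>M \<subseteq> V" by (auto simp: vertex_pairs_eq)
  have "card (V - \<Union>M) = 1"
    using card_Union_matching[OF MV assms(4)] sub assms(1,2)
    by (simp add: card_Diff_subset finite_subset)
  then obtain w where w: "V - \<Union>M = {w}" by (auto simp: card_1_singleton_iff)
  have "\<exists>!e. e \<in> M \<and> v \<in> e" if "v \<in> V - {w}" for v
  proof -
    have "v \<in> \<Union>M" using that w by blast
    then obtain e where "e \<in> M" "v \<in> e" by blast
    then show ?thesis using assms(4) by (auto simp: pairwise_def disjnt_def)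
  qed
  moreover have "w \<in> V" "\<forall>e\<in>M. w \<notin> e" using w by blast+
  ultimately show ?thesis
    using assms(3)
    unfolding almost_perfect_matching_def delete_edges_def fst_conv snd_conv
    by (intro conjI bexI[of _ w] ballI) auto
qed

section \<open>Upper bounds from the edges at two vertices\<close>

text \<open>In a simple graph its cardinality is the degree of \<open>u\<close>. The set itself is
  kept because unions of two such sets are the edge sets to be deleted.\<close>

definition edges_at :: "'a ugraph \<Rightarrow> 'a \<Rightarrow> 'a set set" where
  "edges_at G u = {e \<in> edges G. u \<in> e}"

text \<open>Deleting these edges isolates two vertices, while an almost-perfect matching misses only
  one.\<close>

lemma mp_le_edges_at:
  assumes "u \<in> verts G" "v \<in> verts G" "u \<noteq> v"
  shows "mp G \<le> card (edges_at G u \<union> edges_at G v)"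
proof -
  let ?F = "edges_at G u \<union> edges_at G v"
  have "u \<notin> e \<and> v \<notin> e" if "M \<subseteq> edges (delete_edges G ?F)" "e \<in> M" for M e
    using that by (auto simp: delete_edges_def edges_at_def)
  moreover have "verts (delete_edges G ?F) = verts G" by (simp add: delete_edges_def)
  ultimately have "\<not> perfect_matching (delete_edges G ?F) M"
    "\<not> almost_perfect_matching (delete_edges G ?F) M" for M
    using assms unfolding perfect_matching_def almost_perfect_matching_def
    by (metis, metis Diff_iff singletonD)
  then have "matching_preclusion_set G ?F"
    by (auto simp: matching_preclusion_set_def edges_at_def)
  then show ?thesis unfolding mp_def by (intro Least_le) blast
qed

lemma finite_edges: "simple_graph G \<Longrightarrow> finite (edges G)"
  unfolding simple_graph_def using finite_vertex_pairs finite_subset by blast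

lemma simple_complement: "simple_graph G \<Longrightarrow> simple_graph (complement_graph G)"
  by (auto simp: simple_graph_def complement_graph_def)

lemma card_edges_at_complete:
  assumes "finite V" "u \<in> V" "v \<in> V" "u \<noteq> v"
  shows "card (edges_at (complete_graph V) u \<union> edges_at (complete_graph V) v) = 2 * card V - 3"
proof -
  have "edges_at (complete_graph V) u \<union> edges_at (complete_graph V) v
      = (\<lambda>w. {u, w}) ` (V - {u}) \<union> (\<lambda>w. {v, w}) ` (V - {u, v})" (is "_ = ?A \<union> ?B")
    using assms by (auto simp: edges_at_def complete_graph_def vertex_pairs_def)
  moreover have "card (?A \<union> ?B) = card ?A + card ?B"
    using assms by (intro card_Un_disjoint) (auto simp: doubleton_eq_iff)
  moreover have "card ?A = card V - 1"
    using assms by (subst card_image) (auto simp: inj_on_def doubleton_eq_iff)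
  moreover have "card ?B = card V - 2"
    using assms by (subst card_image) (auto simp: inj_on_def doubleton_eq_iff card_Diff_subset)
  moreover have "2 \<le> card V" using assms card_mono[of V "{u, v}"] by auto
  ultimately show ?thesis by simp
qed

text \<open>Each edge of the complete graph lies in exactly one of \<open>G\<close> and its
  complement, so the bounds that \<open>mp_le_edges_at\<close> gives for the two graphs have a sum
  independent of \<open>u\<close> and \<open>v\<close>.\<close>

lemma card_edges_at_complement:
  assumes "simple_graph G" "u \<in> verts G" "v \<in> verts G" "u \<noteq> v"
  shows "card (edges_at G u \<union> edges_at G v)
    + card (edges_at (complement_graph G) u \<union> edges_at (complement_graph G) v)
    = 2 * card (verts G) - 3" (is "card ?A + card ?B = _")
proof -
  have "card ?A + card ?B = card (?A \<union> ?B)"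
    using finite_edges[OF assms(1)] finite_edges[OF simple_complement[OF assms(1)]]
    by (subst card_Un_disjoint) (auto simp: edges_at_def complement_graph_def)
  also have "?A \<union> ?B
      = edges_at (complete_graph (verts G)) u \<union> edges_at (complete_graph (verts G)) v"
    using assms(1)
    by (auto simp: edges_at_def complement_graph_def complete_graph_def simple_graph_def)
  also have "card \<dots> = 2 * card (verts G) - 3"
    using assms by (intro card_edges_at_complete) (auto simp: simple_graph_def)
  finally show ?thesis .
qed

text \<open>Inclusion-exclusion, where only \<open>{u, v}\<close> can be a common edge. It turns the
  bound on \<open>mp\<close> into degrees.\<close>

lemma card_edges_at_Un:
  assumes "simple_graph G" "u \<noteq> v"
  shows "card (edges_at G u \<union> edges_at G v) + (if {u, v} \<in> edges G then 1 else 0)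
    = card (edges_at G u) + card (edges_at G v)"
proof -
  have "edges_at G u \<inter> edges_at G v = edges G \<inter> {{u, v}}"
    using assms by (auto simp: edges_at_def simple_graph_def elim!: vertex_pairsE)
  then have "card (edges_at G u \<inter> edges_at G v) = (if {u, v} \<in> edges G then 1 else 0)"
    by auto
  then show ?thesis
    using card_Un_Int[of "edges_at G u" "edges_at G v"] finite_edges[OF assms(1)]
    by (simp add: edges_at_def)
qed

section \<open>Complete and empty graphs\<close>

text \<open>Any two vertices give the upper bound. For the lower one, a minimum preclusion set is
  read as the set of non-edges of a graph without a near-perfect matching.\<close>

lemma mp_complete_graph:
  assumes "finite V" "odd (card V)" "card V \<ge> 9"
  shows "mp (complete_graph V) = 2 * card V - 3"
proof (rule antisym)
  have "2 \<le> card V" using assms(3) by simp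
  then obtain e where "e \<subseteq> V" "card e = 2" by (meson obtain_subset_with_card_n)
  then obtain u v where uv: "u \<in> V" "v \<in> V" "u \<noteq> v" by (auto simp: card_2_iff)
  show "mp (complete_graph V) \<le> 2 * card V - 3"
    using mp_le_edges_at[of u "complete_graph V" v] card_edges_at_complete[OF assms(1) uv] uv
    by (simp add: complete_graph_def)
next
  have "simple_graph (complete_graph V)"
    using assms(1) by (simp add: simple_graph_def complete_graph_def)
  then have "\<exists>F. matching_preclusion_set (complete_graph V) F"
    using matching_preclusion_set_edges[of "complete_graph V"] assms(3)
    by (auto simp: complete_graph_def)
  then have "\<exists>k F. matching_preclusion_set (complete_graph V) F \<and> card F = k" by blast
  from LeastI_ex[OF this] obtain F where
    F: "matching_preclusion_set (complete_graph V) F" "card F = mp (complete_graph V)"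
    unfolding mp_def by blast
  obtain k where k: "card V = 2 * k + 1" using assms(2) by (auto elim: oddE)
  have FV: "F \<subseteq> vertex_pairs V"
    using F(1) by (simp add: matching_preclusion_set_def complete_graph_def)
  have "\<nexists>M. M \<subseteq> vertex_pairs V - F \<and> pairwise disjnt M \<and> card M = k"
  proof
    assume "\<exists>M. M \<subseteq> vertex_pairs V - F \<and> pairwise disjnt M \<and> card M = k"
    then obtain M where "almost_perfect_matching (delete_edges (V, vertex_pairs V) F) M"
      using almost_perfect_matchingI[OF assms(1)] k by blast
    then show False using F(1) by (auto simp: matching_preclusion_set_def complete_graph_def)
  qed
  \<comment> \<open>As \<open>card V\<close> is odd and at least 9, \<open>k \<ge> 4\<close>; and
    \<open>4 * k - 1\<close> equals \<open>2 * card V - 3\<close>.\<close>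
  then have "4 * k - 1 \<le> card F"
    using card_non_edges_of_no_near_perfect_matching[OF assms(1) k] FV assms k
      finite_subset[OF FV finite_vertex_pairs] by simp
  then show "2 * card V - 3 \<le> mp (complete_graph V)" using F(2) k by simp
qed

lemma mp_empty_graph:
  assumes "finite (verts G)" "card (verts G) \<ge> 2" "edges G = {}"
  shows "mp G = 0"
proof -
  have "matching_preclusion_set G {}"
    using matching_preclusion_set_edges[of G] assms by (simp add: simple_graph_def)
  then have "mp G \<le> card ({} :: 'a set set)" unfolding mp_def by (intro Least_le) blast
  then show ?thesis by simp
qed

section \<open>The case of equality\<close>

text \<open>The hypothesis reads \<open>d u + d v - [uv \<in> E] = c\<close> for all pairs. If \<open>u\<close> had a
  neighbour \<open>v\<close> and a non-neighbour \<open>w\<close>, then \<open>d v = d w + 1\<close>, so every further vertex would be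
  adjacent to \<open>v\<close> but not to \<open>w\<close>, which makes the difference of the two degrees too large.\<close>

lemma trivial_if_constant_edges_at:
  assumes G: "simple_graph G" and n: "card (verts G) \<ge> 5"
    and const: "\<And>u v. u \<in> verts G \<Longrightarrow> v \<in> verts G \<Longrightarrow> u \<noteq> v \<Longrightarrow>
      card (edges_at G u \<union> edges_at G v) = c"
  shows "edges G = {} \<or> edges G = vertex_pairs (verts G)"
proof -
  let ?V = "verts G" and ?E = "edges G"
  have fE: "finite ?E" by (rule finite_edges[OF G])
  have EV: "?E \<subseteq> vertex_pairs ?V" using G by (simp add: simple_graph_def)
  have fV: "finite ?V" using G by (simp add: simple_graph_def)
  have deg: "c + (if {u, v} \<in> ?E then 1 else 0) = card (edges_at G u) + card (edges_at G v)"
    if "u \<in> ?V" "v \<in> ?V" "u \<noteq> v" for u v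
    using card_edges_at_Un[OF G that(3)] const[OF that] by simp
  have mixed: False
    if V: "u \<in> ?V" "v \<in> ?V" "w \<in> ?V" and uvw: "u \<noteq> v" "u \<noteq> w" and E: "{u, v} \<in> ?E" "{u, w} \<notin> ?E"
    for u v w
  proof -
    have vw: "v \<noteq> w" using E by auto
    have d: "card (edges_at G v) = card (edges_at G w) + 1"
      using deg[OF V(1,2) uvw(1)] deg[OF V(1,3) uvw(2)] E by simp
    \<comment> \<open>Subtracting the degree equations of the pairs \<open>v, t\<close> and
      \<open>w, t\<close> leaves a difference of 1 between the two adjacency indicators, which
      determines both.\<close>
    have t: "{v, t} \<in> ?E \<and> {w, t} \<notin> ?E" if "t \<in> ?V" "t \<noteq> v" "t \<noteq> w" for t
      using deg[OF V(2) that(1)] deg[OF V(3) that(1)] that d by (auto split: if_splits)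
    have "edges_at G w \<subseteq> {{v, w}}"
      using t EV by (force simp: edges_at_def insert_commute elim!: vertex_pairsE)
    then have "card (edges_at G w) \<le> 1" using card_mono[of "{{v, w}}"] by fastforce
    moreover have "3 \<le> card (?V - {v, w})"
      using n V vw fV by (simp add: card_Diff_subset)
    moreover have "card ((\<lambda>t. {v, t}) ` (?V - {v, w})) = card (?V - {v, w})"
      by (rule card_image) (auto simp: inj_on_def doubleton_eq_iff)
    moreover have "(\<lambda>t. {v, t}) ` (?V - {v, w}) \<subseteq> edges_at G v"
      using t by (auto simp: edges_at_def)
    then have "card ((\<lambda>t. {v, t}) ` (?V - {v, w})) \<le> card (edges_at G v)"
      using fE by (intro card_mono) (auto simp: edges_at_def)
    ultimately show False using d by simp
  qed
  show ?thesis
  proof (rule ccontr)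
    assume "\<not> ?thesis"
    then obtain e f where e: "e \<in> ?E" and f: "f \<in> vertex_pairs ?V" "f \<notin> ?E"
      using EV by blast
    obtain a b where ab: "e = {a, b}" "a \<in> ?V" "b \<in> ?V" "a \<noteq> b"
      using subsetD[OF EV e] by (rule vertex_pairsE)
    obtain c d where cd: "f = {c, d}" "c \<in> ?V" "d \<in> ?V" "c \<noteq> d"
      using f(1) by (rule vertex_pairsE)
    \<comment> \<open>By \<open>mixed\<close>, a vertex with a neighbour is adjacent to all other
      vertices. This applies to \<open>a\<close>, then to \<open>c\<close> as a neighbour of
      \<open>a\<close>, and contradicts the non-edge \<open>{c, d}\<close>.\<close>
    have all: "{a, t} \<in> ?E" if "t \<in> ?V" "a \<noteq> t" for t
      using mixed[OF ab(2,3) that(1) ab(4) that(2)] e ab(1) by blast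
    have "a \<noteq> c" using all[of d] cd f(2) by auto
    then have "{c, a} \<in> ?E" using all[OF cd(2)] by (simp add: insert_commute)
    then show False using mixed[OF cd(2) ab(2) cd(3) _ cd(4)] f(2) cd(1) \<open>a \<noteq> c\<close> by blast
  qed
qed

theorem theorem5p4:
  fixes G :: "'a ugraph" and n :: nat
  assumes "simple_graph G"
    and "card (verts G) = n"
    and "odd n"
    and "n \<ge> 9"
  shows "mp G + mp (complement_graph G) = 2 * n - 3 \<longleftrightarrow>
    G = complete_graph (verts G) \<or> complement_graph G = complete_graph (verts G)"
proof
  let ?H = "complement_graph G"
  have vH: "verts ?H = verts G" by (simp add: complement_graph_def)
  assume sum: "mp G + mp ?H = 2 * n - 3"
  \<comment> \<open>The upper bounds for \<open>G\<close> and \<open>?H\<close> sum to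
    \<open>2 * n - 3\<close>, just as the two \<open>mp\<close> values do, so both bounds are
    attained for every pair.\<close>
  have "card (edges_at G u \<union> edges_at G v) = mp G"
    if "u \<in> verts G" "v \<in> verts G" "u \<noteq> v" for u v
    using mp_le_edges_at[OF that] mp_le_edges_at[of u ?H v] that vH sum assms(2)
      card_edges_at_complement[OF assms(1) that] by simp
  then have "edges G = {} \<or> edges G = vertex_pairs (verts G)"
    using assms by (intro trivial_if_constant_edges_at) auto
  then show "G = complete_graph (verts G) \<or> ?H = complete_graph (verts G)"
    by (auto simp: complete_graph_def complement_graph_def prod_eq_iff)
next
  let ?H = "complement_graph G"
  have fV: "finite (verts G)" using assms(1) by (simp add: simple_graph_def)
  have mpK: "mp (complete_graph (verts G)) = 2 * n - 3"
    using mp_complete_graph[OF fV] assms by simp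
  assume "G = complete_graph (verts G) \<or> ?H = complete_graph (verts G)"
  then show "mp G + mp ?H = 2 * n - 3"
  proof
    assume G: "G = complete_graph (verts G)"
    then have "edges G = vertex_pairs (verts G)" by (simp add: complete_graph_def prod_eq_iff)
    then have "mp ?H = 0"
      using fV assms by (intro mp_empty_graph) (auto simp: complement_graph_def)
    then show ?thesis using mpK G by simp
  next
    assume H: "?H = complete_graph (verts G)"
    then have "edges G = {}"
      using assms(1) by (auto simp: complete_graph_def complement_graph_def simple_graph_def)
    then have "mp G = 0" using fV assms by (intro mp_empty_graph) auto
    then show ?thesis using mpK H by simp
  qed
qed

end
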